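(* (1) Every Conway cut $\langle L,R\rangle$ in the class $\mathbb{NO}$ of numbers determines a unique number $c=[\langle L,R\rangle]$ such that (i) $L<c<R$, i.e. $a<c<b$ for all $a\in L$, $b\in R$; (ii) $\mathrm{b}(c)$ is minimal with respect to (i). Moreover, if $y$ is a number such that $L<y<R$, then $c\preceq y$. (2) Let $\alpha$ be an ordinal. For every Cuesta-Dutari cut $\langle L,R\rangle$ in $\mathbb{NO}_\alpha$, the number $c=[\langle L,R\rangle]$ belongs to $\partial(\mathbb{NO}_\alpha)$. Conversely, every number $c\in\partial(\mathbb{NO}_\alpha)$ gives rise to a Cuesta-Dutari cut $\langle L^c,R^c\rangle$ in $\mathbb{NO}_\alpha$: $$L^c=\{y\mid\mathrm{b}(y)<\alpha,\ y<c\},\qquad R^c=\{z\mid\mathrm{b}(z)<\alpha,\ z>c\}.$$ Both constructions are inverse to each other. Thus $\mathbb{NO}_{\alpha+1}=\mathbb{NO}_\alpha\cup\partial(\mathbb{NO}_\alpha)$ is the Cuesta-Dutari completion of $\mathbb{NO}_\alpha$.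
   Context: A number is a set $x$ of (von Neumann) ordinals having a maximal element $\mathrm{b}(x)$ (birthday). $\mathbb{NO}$ is the class of all numbers; $\mathbb{NO}_\alpha=\{x\mid\mathrm{b}(x)<\alpha\}$; $\partial(\mathbb{NO}_\alpha)=\{x\mid\mathrm{b}(x)=\alpha\}$. Total order: $x<y$ iff $x\ne y$ and $\min(x\Delta y)\in y$ ($\Delta$ = symmetric difference). $x\preceq y$ means: $\mathrm{b}(x)\le\mathrm{b}(y)$ and for all $\beta<\mathrm{b}(x)$, $\beta\in x\Leftrightarrow\beta\in y$. A Conway cut in a totally ordered class $N$ is an ordered pair $\langle L,R\rangle$ of (possibly empty) sets $L,R\subset N$ with $a<b$ for all $a\in L,b\in R$; it is a Cuesta-Dutari cut (in a totally ordered set $N$) if moreover $N=L\cup R$. The Cuesta-Dutari completion of a totally ordered set $N$ is the disjoint union of $N$ with the set of its Cuesta-Dutari cuts, with the order extending that of $N$ by: $x<(A,B)$ if $x\in A$, $(A,B)<y$ if $y\in B$, and $(A,B)<(A',B')$ if $A\subsetneq A'$; here numbers $c\in\partial(\mathbb{NO}_\alpha)$ are identified with their cuts $\langle L^c,R^c\rangle$. *)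

theory Defs
  imports Main
begin

text \<open>
  The theorem speaks about all von Neumann ordinals and about sets versus proper classes, so it is
  stated over a set-theoretic universe: the elements of a type of class \<open>zf\<close> are the sets,
  arbitrary HOL sets of such elements are the classes, and \<open>elts x\<close> is the extension of the set
  \<open>x\<close>. The axioms are those of ZFC without Infinity and Choice, which are not needed; replacement
  and separation quantify over all functions and all classes, as in Morse-Kelley class theory.
  Pairing and the empty set are derivable.
\<close>

class zf =
  fixes elts :: "'a \<Rightarrow> 'a set"
  assumes extensionality: "elts x = elts y \<Longrightarrow> x = y"
    and foundation: "wf {(x, y). x \<in> elts y}"
    and separation: "A \<subseteq> elts x \<Longrightarrow> A \<in> range elts"
    and union: "(\<Union>y\<in>elts x. elts y) \<in> range elts"
    and power: "{y. elts y \<subseteq> elts x} \<in> range elts"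
    and replacement: "F ` elts x \<in> range elts"

definition is_set :: "'v::zf set \<Rightarrow> bool" where
  "is_set A \<longleftrightarrow> A \<in> range elts"

text \<open>Well-foundedness of membership on an ordinal comes from the foundation axiom.\<close>

definition ordinal :: "'v::zf \<Rightarrow> bool" where
  "ordinal \<alpha> \<longleftrightarrow>
     (\<forall>\<beta>\<in>elts \<alpha>. elts \<beta> \<subseteq> elts \<alpha>) \<and>
     (\<forall>\<beta>\<in>elts \<alpha>. \<forall>\<gamma>\<in>elts \<alpha>. \<beta> \<in> elts \<gamma> \<or> \<beta> = \<gamma> \<or> \<gamma> \<in> elts \<beta>)"

text \<open>On ordinals, \<open>\<alpha> < \<beta>\<close> is \<open>\<alpha> \<in> elts \<beta>\<close>.\<close>

definition ord_le :: "'v::zf \<Rightarrow> 'v \<Rightarrow> bool" where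
  "ord_le \<alpha> \<beta> \<longleftrightarrow> \<alpha> \<in> elts \<beta> \<or> \<alpha> = \<beta>"

definition ord_succ :: "'v::zf \<Rightarrow> 'v" where
  "ord_succ \<alpha> = (THE \<beta>. elts \<beta> = insert \<alpha> (elts \<alpha>))"

definition is_least :: "'v::zf set \<Rightarrow> 'v \<Rightarrow> bool" where
  "is_least A \<beta> \<longleftrightarrow> \<beta> \<in> A \<and> (\<forall>\<gamma>\<in>A. ord_le \<beta> \<gamma>)"

definition is_greatest :: "'v::zf set \<Rightarrow> 'v \<Rightarrow> bool" where
  "is_greatest A \<beta> \<longleftrightarrow> \<beta> \<in> A \<and> (\<forall>\<gamma>\<in>A. ord_le \<gamma> \<beta>)"

definition NO :: "'v::zf set" where
  "NO = {x. (\<forall>\<beta>\<in>elts x. ordinal \<beta>) \<and> (\<exists>\<beta>. is_greatest (elts x) \<beta>)}"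

definition birthday :: "'v::zf \<Rightarrow> 'v" where
  "birthday x = (THE \<beta>. is_greatest (elts x) \<beta>)"

definition NO_below :: "'v::zf \<Rightarrow> 'v set" where
  "NO_below \<alpha> = {x \<in> NO. birthday x \<in> elts \<alpha>}"

text \<open>\<open>NO_bd \<alpha>\<close> is the boundary $\partial(\mathbb{NO}_\alpha)$.\<close>

definition NO_bd :: "'v::zf \<Rightarrow> 'v set" where
  "NO_bd \<alpha> = {x \<in> NO. birthday x = \<alpha>}"

definition num_less :: "'v::zf \<Rightarrow> 'v \<Rightarrow> bool" where
  "num_less x y \<longleftrightarrow>
     x \<noteq> y \<and> (THE \<delta>. is_least ((elts x - elts y) \<union> (elts y - elts x)) \<delta>) \<in> elts y"

text \<open>The relation $x \preceq y$ on numbers.\<close>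

definition simpler :: "'v::zf \<Rightarrow> 'v \<Rightarrow> bool" where
  "simpler x y \<longleftrightarrow>
     ord_le (birthday x) (birthday y) \<and>
     (\<forall>\<beta>\<in>elts (birthday x). \<beta> \<in> elts x \<longleftrightarrow> \<beta> \<in> elts y)"

text \<open>
  A cut is a pair of HOL sets whose components are sets of the universe. The totally ordered
  class is given by its carrier \<open>N\<close> and its strict order \<open>lt\<close>.
\<close>

type_synonym 'v cut = "'v set \<times> 'v set"

fun conway_cut :: "('v::zf \<Rightarrow> 'v \<Rightarrow> bool) \<Rightarrow> 'v set \<Rightarrow> 'v cut \<Rightarrow> bool" where
  "conway_cut lt N (L, R) \<longleftrightarrow>
     is_set L \<and> is_set R \<and> L \<subseteq> N \<and> R \<subseteq> N \<and> (\<forall>a\<in>L. \<forall>b\<in>R. lt a b)"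

fun cd_cut :: "('v::zf \<Rightarrow> 'v \<Rightarrow> bool) \<Rightarrow> 'v set \<Rightarrow> 'v cut \<Rightarrow> bool" where
  "cd_cut lt N (L, R) \<longleftrightarrow> conway_cut lt N (L, R) \<and> N = L \<union> R"

definition cd_completion ::
  "('v::zf \<Rightarrow> 'v \<Rightarrow> bool) \<Rightarrow> 'v set \<Rightarrow> ('v + 'v cut) set" where
  "cd_completion lt N = N <+> {C. cd_cut lt N C}"

fun cd_less :: "('v::zf \<Rightarrow> 'v \<Rightarrow> bool) \<Rightarrow> 'v + 'v cut \<Rightarrow> 'v + 'v cut \<Rightarrow> bool" where
  "cd_less lt (Inl x) (Inl y) \<longleftrightarrow> lt x y"
| "cd_less lt (Inl x) (Inr (A, B)) \<longleftrightarrow> x \<in> A"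
| "cd_less lt (Inr (A, B)) (Inl y) \<longleftrightarrow> y \<in> B"
| "cd_less lt (Inr (A, B)) (Inr (A', B')) \<longleftrightarrow> A \<subset> A'"

definition strictly_ordered :: "('v \<Rightarrow> 'v \<Rightarrow> bool) \<Rightarrow> 'v set \<Rightarrow> bool" where
  "strictly_ordered lt N \<longleftrightarrow> irreflp_on N lt \<and> transp_on N lt \<and> totalp_on N lt"

text \<open>
  \<open>M\<close> is the Cuesta-Dutari completion of the totally ordered set \<open>N\<close>, under an identification
  \<open>\<phi>\<close> of the elements of \<open>M\<close> with elements and cuts of \<open>N\<close> that is the identity on \<open>N\<close>.
\<close>

definition is_cd_completion ::
  "('v::zf \<Rightarrow> 'v + 'v cut) \<Rightarrow> ('v \<Rightarrow> 'v \<Rightarrow> bool) \<Rightarrow> 'v set \<Rightarrow> 'v set \<Rightarrow> bool" where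
  "is_cd_completion \<phi> lt M N \<longleftrightarrow>
     is_set N \<and> strictly_ordered lt N \<and>
     bij_betw \<phi> M (cd_completion lt N) \<and>
     (\<forall>x\<in>N. \<phi> x = Inl x) \<and>
     (\<forall>x\<in>M. \<forall>y\<in>M. lt x y \<longleftrightarrow> cd_less lt (\<phi> x) (\<phi> y))"

fun between :: "'v::zf cut \<Rightarrow> 'v \<Rightarrow> bool" where
  "between (L, R) c \<longleftrightarrow> (\<forall>a\<in>L. num_less a c) \<and> (\<forall>b\<in>R. num_less c b)"

definition simplest_between :: "'v::zf cut \<Rightarrow> 'v \<Rightarrow> bool" where
  "simplest_between C c \<longleftrightarrow>
     c \<in> NO \<and> between C c \<and>
     (\<forall>d\<in>NO. between C d \<longrightarrow> ord_le (birthday c) (birthday d))"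

text \<open>The number $[\langle L,R\rangle]$ determined by a cut.\<close>

definition cut_number :: "'v::zf cut \<Rightarrow> 'v" where
  "cut_number C = (THE c. simplest_between C c)"

text \<open>The pair $\langle L^c,R^c\rangle$ of a number $c \in \partial(\mathbb{NO}_\alpha)$.\<close>

definition number_cut :: "'v::zf \<Rightarrow> 'v \<Rightarrow> 'v cut" where
  "number_cut \<alpha> c =
     ({y \<in> NO. birthday y \<in> elts \<alpha> \<and> num_less y c},
      {z \<in> NO. birthday z \<in> elts \<alpha> \<and> num_less c z})"

end

theory Submission
  imports Defs
begin

text \<open>
  A number \<open>x\<close> is the sign sequence of length \<open>birthday x\<close> that has a plus exactly at the positions
  \<open>\<beta> < birthday x\<close> with \<open>\<beta> \<in> elts x\<close>; the element \<open>birthday x\<close> itself marks the end of the sequence.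
  The order of numbers is the lexicographic order of characteristic functions, and \<open>simpler\<close> is
  the initial segment relation.

  A cut \<open>(L, R)\<close> is filled as follows. If \<open>\<alpha>\<close> is an ordinal above all birthdays in \<open>L \<union> R\<close>, then the
  members of \<open>L\<close> and \<open>R\<close> are subsets of \<open>\<alpha>\<close>, and the lexicographic order on the subsets of \<open>\<alpha>\<close> is
  complete. Let \<open>s\<close> be the supremum of \<open>L\<close>, computed by recursion on the positions
  (\<open>lex_sup\<close>). Then \<open>s \<union> {\<alpha>}\<close> is a number of birthday \<open>\<alpha>\<close>, and it lies strictly between \<open>L\<close> and
  \<open>R\<close> (\<open>cut_filled_at_ordinal\<close>): the new element \<open>\<alpha>\<close> lifts it above \<open>s\<close>, whereas \<open>s\<close> cannot belong
  to \<open>R\<close>, because a last element of \<open>s\<close> would be contributed by a member of \<open>L\<close> that is at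
  least \<open>s\<close>.

  Among the numbers between \<open>L\<close> and \<open>R\<close>, one of minimal birthday is an initial segment of every
  other one, \<open>y\<close>: if the two branched at a position \<open>\<delta>\<close> below the minimal birthday, their common
  part of length \<open>\<delta>\<close> would be a number weakly between them (\<open>branching_point\<close>), hence between
  \<open>L\<close> and \<open>R\<close>, and it would be born earlier. Two numbers that are initial segments of each other are
  equal, so the simplest number is unique.

  If \<open>L \<union> R\<close> consists of all numbers born before \<open>\<alpha>\<close>, the simplest number \<open>c\<close> is born by \<open>\<alpha>\<close> because
  the cut is filled at \<open>\<alpha>\<close>, and not before \<open>\<alpha>\<close>, since otherwise \<open>c \<in> L \<union> R\<close> would give
  \<open>c < c\<close>. That the two constructions are inverse, and that \<open>c < c'\<close> corresponds to inclusion
  of lower sections, then follows formally from the linearity of the order.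
\<close>

section \<open>Sets and ordinals\<close>

lemma elts_minimal:
  fixes A :: "'v::zf set"
  assumes "x \<in> A"
  obtains m where "m \<in> A" "\<And>z. z \<in> elts m \<Longrightarrow> z \<notin> A"
  using wfE_min[OF foundation assms] by (metis (mono_tags, lifting) case_prodI mem_Collect_eq)

lemma mem_irrefl: "x \<notin> elts (x::'v::zf)"
  using wf_not_refl[OF foundation] by blast

lemma mem_asym: "x \<in> elts (y::'v::zf) \<Longrightarrow> y \<notin> elts x"
  using wf_not_sym[OF foundation] by blast

lemma mem_no_3cycle:
  fixes x y z :: "'v::zf"
  assumes "x \<in> elts y" "y \<in> elts z"
  shows "z \<notin> elts x"
  by (rule elts_minimal[of x "{x, y, z}"]) (use assms in auto)

lemma is_set_subset: "A \<subseteq> elts x \<Longrightarrow> is_set A"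
  unfolding is_set_def by (rule separation)

lemma is_setE:
  assumes "is_set A"
  obtains x where "elts x = A"
  using assms unfolding is_set_def by blast

lemma ordinal_trans: "\<lbrakk>ordinal \<gamma>; \<alpha> \<in> elts \<beta>; \<beta> \<in> elts \<gamma>\<rbrakk> \<Longrightarrow> \<alpha> \<in> elts \<gamma>"
  unfolding ordinal_def by blast

lemma ordinal_elt:
  fixes \<alpha> :: "'v::zf"
  assumes "ordinal \<alpha>" "\<beta> \<in> elts \<alpha>"
  shows "ordinal \<beta>"
  unfolding ordinal_def
proof (intro conjI ballI subsetI)
  fix \<gamma> \<delta> assume "\<gamma> \<in> elts \<beta>" "\<delta> \<in> elts \<gamma>"
  moreover from this have "\<delta> \<in> elts \<alpha>"
    using assms ordinal_trans by blast
  ultimately show "\<delta> \<in> elts \<beta>"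
    using assms mem_asym mem_no_3cycle unfolding ordinal_def by metis
next
  fix \<gamma> \<delta> assume "\<gamma> \<in> elts \<beta>" "\<delta> \<in> elts \<beta>"
  then have "\<gamma> \<in> elts \<alpha>" "\<delta> \<in> elts \<alpha>"
    using assms ordinal_trans by blast+
  then show "\<gamma> \<in> elts \<delta> \<or> \<gamma> = \<delta> \<or> \<delta> \<in> elts \<gamma>"
    using assms unfolding ordinal_def by blast
qed

lemma ordinal_linear:
  fixes \<alpha> \<beta> :: "'v::zf"
  assumes "ordinal \<alpha>" "ordinal \<beta>"
  shows "\<alpha> \<in> elts \<beta> \<or> \<alpha> = \<beta> \<or> \<beta> \<in> elts \<alpha>"
  using assms
proof (induction \<alpha> arbitrary: \<beta> rule: wf_induct_rule[OF foundation])
  case outer: (1 \<alpha>)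
  from outer.prems(2) show ?case
  proof (induction \<beta> rule: wf_induct_rule[OF foundation])
    case inner: (1 \<beta>)
    show ?case
    proof (rule ccontr)
      assume incomparable: "\<not> ?case"
      have "\<gamma> \<in> elts \<beta>" if "\<gamma> \<in> elts \<alpha>" for \<gamma>
        using outer.IH[of \<gamma> \<beta>] that outer.prems(1) inner.prems incomparable
        by (auto dest: ordinal_elt ordinal_trans)
      moreover have "\<gamma> \<in> elts \<alpha>" if "\<gamma> \<in> elts \<beta>" for \<gamma>
        using inner.IH[of \<gamma>] that outer.prems(1) inner.prems incomparable
        by (auto dest: ordinal_elt ordinal_trans)
      ultimately have "\<alpha> = \<beta>"
        by (intro extensionality) blast
      with incomparable show False by blast
    qed
  qed
qed

lemma ord_le_antisym: "\<lbrakk>ord_le \<alpha> \<beta>; ord_le \<beta> \<alpha>\<rbrakk> \<Longrightarrow> \<alpha> = (\<beta>::'v::zf)"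
  unfolding ord_le_def using mem_asym by blast

lemma ordinal_not_mem: "\<lbrakk>ordinal \<alpha>; ordinal \<beta>; \<beta> \<notin> elts \<alpha>\<rbrakk> \<Longrightarrow> ord_le \<alpha> (\<beta>::'v::zf)"
  unfolding ord_le_def using ordinal_linear by blast

text \<open>
  A transitive set satisfies \<open>\<alpha> \<union> {\<alpha>} \<subseteq> Pow \<alpha>\<close>, so the successor is a set by power set and
  separation alone.
\<close>

lemma is_set_insert_ordinal:
  fixes \<alpha> :: "'v::zf"
  assumes "ordinal \<alpha>" "A \<subseteq> elts \<alpha>"
  shows "is_set (insert \<alpha> A)"
proof -
  obtain P where "elts P = {y. elts y \<subseteq> elts \<alpha>}"
    using power[of \<alpha>] by (metis imageE)
  with assms show ?thesis
    by (intro is_set_subset[of _ P]) (auto simp: ordinal_def)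
qed

lemma elts_ord_succ:
  fixes \<alpha> :: "'v::zf"
  assumes "ordinal \<alpha>"
  shows "elts (ord_succ \<alpha>) = insert \<alpha> (elts \<alpha>)"
proof -
  obtain \<beta> where "elts \<beta> = insert \<alpha> (elts \<alpha>)"
    using is_set_insert_ordinal[OF assms order_refl] by (rule is_setE)
  moreover from this have "ord_succ \<alpha> = \<beta>"
    unfolding ord_succ_def by (intro the_equality) (auto intro: extensionality)
  ultimately show ?thesis by simp
qed

lemma ordinal_ord_succ:
  fixes \<alpha> :: "'v::zf"
  assumes "ordinal \<alpha>"
  shows "ordinal (ord_succ \<alpha>)"
  using assms unfolding ordinal_def elts_ord_succ[OF assms] by blast

text \<open>
  The union of \<open>A\<close> is an upper bound that may itself belong to \<open>A\<close>; its successor is a strict one.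
\<close>

lemma ordinals_bounded:
  fixes A :: "'v::zf set"
  assumes "is_set A" "\<And>\<beta>. \<beta> \<in> A \<Longrightarrow> ordinal \<beta>"
  obtains \<alpha> where "ordinal \<alpha>" "A \<subseteq> elts \<alpha>"
proof -
  from assms(1) obtain X where X: "elts X = A"
    by (rule is_setE)
  obtain \<sigma> where \<sigma>: "elts \<sigma> = (\<Union>\<beta>\<in>A. elts \<beta>)"
    using union[of X] X by (metis imageE)
  have ord: "ordinal \<sigma>"
    unfolding ordinal_def
  proof (intro conjI ballI subsetI)
    fix \<beta> \<gamma> assume "\<beta> \<in> elts \<sigma>" "\<gamma> \<in> elts \<beta>"
    then show "\<gamma> \<in> elts \<sigma>"
      unfolding \<sigma> using assms(2) ordinal_trans by blast
  next
    fix \<beta> \<gamma> assume "\<beta> \<in> elts \<sigma>" "\<gamma> \<in> elts \<sigma>"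
    then have "ordinal \<beta>" "ordinal \<gamma>"
      unfolding \<sigma> using assms(2) ordinal_elt by blast+
    then show "\<beta> \<in> elts \<gamma> \<or> \<beta> = \<gamma> \<or> \<gamma> \<in> elts \<beta>"
      by (rule ordinal_linear)
  qed
  have "\<beta> \<in> elts (ord_succ \<sigma>)" if "\<beta> \<in> A" for \<beta>
  proof -
    have "\<sigma> \<notin> elts \<beta>"
      using that \<sigma> mem_irrefl[of \<sigma>] by blast
    then show ?thesis
      using ordinal_linear[OF assms(2)[OF that] ord] by (auto simp: elts_ord_succ[OF ord])
  qed
  then show ?thesis
    using ord ordinal_ord_succ by (intro that[of "ord_succ \<sigma>"]) auto
qed

section \<open>Numbers and their birthdays\<close>

lemma birthday_eqI: "is_greatest (elts x) \<beta> \<Longrightarrow> birthday x = (\<beta>::'v::zf)"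
  unfolding birthday_def
  by (rule the_equality) (auto simp: is_greatest_def intro: ord_le_antisym)

lemma NO_ordinal: "\<lbrakk>x \<in> NO; \<beta> \<in> elts x\<rbrakk> \<Longrightarrow> ordinal \<beta>"
  unfolding NO_def by blast

lemma is_greatest_birthday: "x \<in> NO \<Longrightarrow> is_greatest (elts x) (birthday (x::'v::zf))"
  using birthday_eqI unfolding NO_def by blast

lemma birthday_mem: "x \<in> NO \<Longrightarrow> birthday (x::'v::zf) \<in> elts x"
  using is_greatest_birthday unfolding is_greatest_def by blast

lemma ordinal_birthday: "x \<in> NO \<Longrightarrow> ordinal (birthday (x::'v::zf))"
  using birthday_mem NO_ordinal by blast

lemma elts_le_birthday: "\<lbrakk>x \<in> NO; \<beta> \<in> elts x\<rbrakk> \<Longrightarrow> ord_le \<beta> (birthday (x::'v::zf))"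
  using is_greatest_birthday unfolding is_greatest_def by blast

lemma elts_subset_ordinal:
  fixes x :: "'v::zf"
  assumes "x \<in> NO" "ordinal \<alpha>" "birthday x \<in> elts \<alpha>"
  shows "elts x \<subseteq> elts \<alpha>"
  using assms elts_le_birthday ordinal_trans unfolding ord_le_def by blast

lemma number_with_birthday:
  fixes \<alpha> :: "'v::zf"
  assumes "ordinal \<alpha>" "A \<subseteq> elts \<alpha>"
  obtains x where "x \<in> NO" "birthday x = \<alpha>" "elts x = insert \<alpha> A"
proof -
  obtain x where x: "elts x = insert \<alpha> A"
    using is_set_insert_ordinal[OF assms] by (rule is_setE)
  have "is_greatest (elts x) \<alpha>"
    unfolding is_greatest_def ord_le_def using x assms(2) by auto
  moreover from this have "x \<in> NO"
    unfolding NO_def using x assms ordinal_elt by auto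
  ultimately show ?thesis
    using that x birthday_eqI by blast
qed

lemma is_set_NO_below:
  fixes \<alpha> :: "'v::zf"
  assumes "ordinal \<alpha>"
  shows "is_set (NO_below \<alpha>)"
proof -
  obtain P where "elts P = {y. elts y \<subseteq> elts \<alpha>}"
    using power[of \<alpha>] by (metis imageE)
  then show ?thesis
    using elts_subset_ordinal[OF _ assms]
    by (intro is_set_subset[of _ P]) (auto simp: NO_below_def)
qed

lemma NO_bd_disjoint: "x \<in> NO_bd \<alpha> \<Longrightarrow> x \<notin> NO_below (\<alpha>::'v::zf)"
  unfolding NO_bd_def NO_below_def using mem_irrefl by blast

lemma NO_below_ord_succ:
  fixes \<alpha> :: "'v::zf"
  assumes "ordinal \<alpha>"
  shows "NO_below (ord_succ \<alpha>) = NO_below \<alpha> \<union> NO_bd \<alpha>"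
  unfolding NO_below_def NO_bd_def elts_ord_succ[OF assms] by blast

section \<open>The lexicographic order\<close>

definition agree_below :: "'v::zf \<Rightarrow> 'v \<Rightarrow> 'v \<Rightarrow> bool" where
  "agree_below \<delta> x y \<longleftrightarrow> (\<forall>\<gamma>\<in>elts \<delta>. \<gamma> \<in> elts x \<longleftrightarrow> \<gamma> \<in> elts y)"

definition less_at :: "'v::zf \<Rightarrow> 'v \<Rightarrow> 'v \<Rightarrow> bool" where
  "less_at \<delta> x y \<longleftrightarrow> \<delta> \<in> elts y \<and> \<delta> \<notin> elts x \<and> agree_below \<delta> x y"

text \<open>
  Foundation gives a \<open>\<in>\<close>-minimal element of the symmetric difference, and it is the least one because
  the elements of numbers are ordinals. This removes the definite description from the arguments
  about the order.
\<close>

lemma num_less_iff: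
  fixes x y :: "'v::zf"
  assumes "x \<in> NO" "y \<in> NO"
  shows "num_less x y \<longleftrightarrow> (\<exists>\<delta>. less_at \<delta> x y)"
proof -
  let ?D = "(elts x - elts y) \<union> (elts y - elts x)"
  have least: "(THE \<delta>. is_least ?D \<delta>) = \<delta>"
    if "\<delta> \<in> ?D" "\<And>\<gamma>. \<gamma> \<in> elts \<delta> \<Longrightarrow> \<gamma> \<notin> ?D" for \<delta>
  proof -
    have "ord_le \<delta> \<gamma>" if "\<gamma> \<in> ?D" for \<gamma>
      using that \<open>\<delta> \<in> ?D\<close> \<open>\<And>\<gamma>. \<gamma> \<in> elts \<delta> \<Longrightarrow> \<gamma> \<notin> ?D\<close> assms NO_ordinal
      by (intro ordinal_not_mem) auto
    then have "is_least ?D \<delta>"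
      using that(1) unfolding is_least_def by blast
    then show ?thesis
      by (intro the_equality) (auto simp: is_least_def intro: ord_le_antisym)
  qed
  show ?thesis
  proof
    assume less: "num_less x y"
    then have "x \<noteq> y"
      unfolding num_less_def by blast
    then obtain \<beta> where "\<beta> \<in> ?D"
      using extensionality by blast
    then obtain \<delta> where \<delta>: "\<delta> \<in> ?D" "\<And>\<gamma>. \<gamma> \<in> elts \<delta> \<Longrightarrow> \<gamma> \<notin> ?D"
      using elts_minimal[of \<beta> ?D] by blast
    then have "\<delta> \<in> elts y"
      using less least[OF \<delta>] unfolding num_less_def by simp
    with \<delta> have "less_at \<delta> x y"
      unfolding less_at_def agree_below_def by blast
    then show "\<exists>\<delta>. less_at \<delta> x y" ..
  next
    assume "\<exists>\<delta>. less_at \<delta> x y"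
    then obtain \<delta> where "less_at \<delta> x y" ..
    then have \<delta>: "\<delta> \<in> ?D" "\<And>\<gamma>. \<gamma> \<in> elts \<delta> \<Longrightarrow> \<gamma> \<notin> ?D" "\<delta> \<in> elts y"
      unfolding less_at_def agree_below_def by blast+
    then show "num_less x y"
      using least[OF \<delta>(1,2)] unfolding num_less_def by auto
  qed
qed

lemma num_lessI: "\<lbrakk>x \<in> NO; y \<in> NO; less_at \<delta> x y\<rbrakk> \<Longrightarrow> num_less x y"
  using num_less_iff by blast

lemma num_less_irrefl: "\<not> num_less x x"
  unfolding num_less_def by blast

lemma num_less_linear:
  fixes x y :: "'v::zf"
  assumes "x \<in> NO" "y \<in> NO" "x \<noteq> y"
  shows "num_less x y \<or> num_less y x"
proof -
  let ?D = "(elts x - elts y) \<union> (elts y - elts x)"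
  obtain \<beta> where "\<beta> \<in> ?D"
    using assms(3) extensionality by blast
  then obtain \<delta> where "\<delta> \<in> ?D" "\<And>\<gamma>. \<gamma> \<in> elts \<delta> \<Longrightarrow> \<gamma> \<notin> ?D"
    using elts_minimal[of \<beta> ?D] by blast
  then have "less_at \<delta> x y \<or> less_at \<delta> y x"
    unfolding less_at_def agree_below_def by blast
  then show ?thesis
    using assms num_lessI by blast
qed

text \<open>The earlier of the two branching points decides how \<open>x\<close> compares with \<open>z\<close>.\<close>

lemma num_less_trans:
  fixes x y z :: "'v::zf"
  assumes NO: "x \<in> NO" "y \<in> NO" "z \<in> NO" and "num_less x y" "num_less y z"
  shows "num_less x z"
proof -
  obtain \<delta> \<epsilon> where \<delta>: "less_at \<delta> x y" and \<epsilon>: "less_at \<epsilon> y z"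
    using assms num_less_iff by blast
  have ord: "ordinal \<delta>" "ordinal \<epsilon>"
    using \<delta> \<epsilon> NO NO_ordinal unfolding less_at_def by blast+
  have "\<delta> \<noteq> \<epsilon>"
    using \<delta> \<epsilon> unfolding less_at_def by blast
  then consider "\<delta> \<in> elts \<epsilon>" | "\<epsilon> \<in> elts \<delta>"
    using ordinal_linear[OF ord] by blast
  then show ?thesis
  proof cases
    case 1
    then have "less_at \<delta> x z"
      using \<delta> \<epsilon> ordinal_trans[OF ord(2)] unfolding less_at_def agree_below_def by blast
    then show ?thesis using NO num_lessI by blast
  next
    case 2
    then have "less_at \<epsilon> x z"
      using \<delta> \<epsilon> ordinal_trans[OF ord(1)] unfolding less_at_def agree_below_def by blast
    then show ?thesis using NO num_lessI by blast
  qed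
qed

lemma num_less_asym: "\<lbrakk>x \<in> NO; y \<in> NO; num_less x y\<rbrakk> \<Longrightarrow> \<not> num_less y (x::'v::zf)"
  using num_less_trans num_less_irrefl by blast

text \<open>
  The witness is the common initial segment of \<open>x\<close> and \<open>y\<close>. Ending at \<open>\<delta>\<close>, it
  contains \<open>\<delta>\<close> as its last element: this puts it above \<open>x\<close>, while \<open>y\<close> agrees with it up to and
  including \<open>\<delta>\<close> and can only have further elements.
\<close>

lemma branching_point:
  fixes x y :: "'v::zf"
  assumes NO: "x \<in> NO" "y \<in> NO" and less: "less_at \<delta> x y"
  obtains d where "d \<in> NO" "birthday d = \<delta>" "num_less x d" "d = y \<or> num_less d y"
proof -
  have "ordinal \<delta>"
    using NO less NO_ordinal unfolding less_at_def by blast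
  then obtain d where d: "d \<in> NO" "birthday d = \<delta>" "elts d = insert \<delta> (elts x \<inter> elts \<delta>)"
    by (rule number_with_birthday[OF _ Int_lower2])
  have "less_at \<delta> x d"
    using less mem_irrefl[of \<delta>] unfolding less_at_def agree_below_def by (auto simp: d(3))
  then have "num_less x d"
    using NO d num_lessI by blast
  moreover have "\<not> num_less y d"
  proof
    assume "num_less y d"
    then obtain \<epsilon> where "less_at \<epsilon> y d"
      using NO d num_less_iff by blast
    then show False
      using less unfolding less_at_def agree_below_def by (auto simp: d(3))
  qed
  ultimately show ?thesis
    using that d NO num_less_linear by blast
qed

section \<open>Filling a cut\<close>

text \<open>
  The lexicographic supremum of the members of \<open>L\<close>, as a predicate on positions. The condition on the
  earlier positions \<open>\<gamma>\<close> is not monotone in \<open>S\<close>, hence the well-founded recursion instead of an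
  inductive definition.
\<close>

definition lex_sup :: "'v::zf set \<Rightarrow> 'v \<Rightarrow> bool" where
  "lex_sup L = wfrec {(x, y). x \<in> elts y}
     (\<lambda>S \<beta>. \<exists>x\<in>L. \<beta> \<in> elts x \<and> (\<forall>\<gamma>\<in>elts \<beta>. \<gamma> \<in> elts x \<longleftrightarrow> S \<gamma>))"

lemma lex_sup_iff:
  "lex_sup L \<beta> \<longleftrightarrow> (\<exists>x\<in>L. \<beta> \<in> elts x \<and> (\<forall>\<gamma>\<in>elts \<beta>. \<gamma> \<in> elts x \<longleftrightarrow> lex_sup L \<gamma>))"
  by (subst def_wfrec[OF lex_sup_def[THEN eq_reflection] foundation]) (simp add: cut_apply)

text \<open>
  The number is the supremum \<open>s\<close> of \<open>L\<close> with \<open>\<alpha>\<close> added. A member of \<open>L\<close> above it would branch from it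
  at a position that the recursion puts into \<open>s\<close>. A member \<open>b\<close> of \<open>R\<close> below it would branch from it
  at a position of \<open>s\<close> or at \<open>\<alpha>\<close>, and in both cases the recursion supplies a member of \<open>L\<close> that is
  not below \<open>b\<close>.
\<close>

lemma cut_filled_at_ordinal:
  fixes L R :: "'v::zf set"
  assumes cut: "conway_cut num_less NO (L, R)" and \<alpha>: "ordinal \<alpha>"
    and born: "\<And>x. x \<in> L \<union> R \<Longrightarrow> birthday x \<in> elts \<alpha>"
  obtains c where "c \<in> NO_bd \<alpha>" "between (L, R) c"
proof -
  have LR: "x \<in> NO" "elts x \<subseteq> elts \<alpha>" if "x \<in> L \<union> R" for x
    using that cut born elts_subset_ordinal[OF _ \<alpha>] by auto
  obtain c where c: "c \<in> NO" "birthday c = \<alpha>" "elts c = insert \<alpha> {\<beta> \<in> elts \<alpha>. lex_sup L \<beta>}"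
    using \<alpha> by (rule number_with_birthday[OF _ Collect_restrict])
  have \<alpha>_notin: "\<alpha> \<notin> elts x" if "x \<in> L \<union> R" for x
    using LR(2)[OF that] mem_irrefl by blast
  have mem_c: "\<beta> \<in> elts c \<longleftrightarrow> lex_sup L \<beta>" if "\<beta> \<in> elts \<alpha>" for \<beta>
    using that mem_irrefl[of \<alpha>] by (auto simp: c(3))
  have witness: "\<exists>x\<in>L. \<beta> \<in> elts x \<and> agree_below \<beta> x c" if "\<beta> \<in> elts \<alpha>" "\<beta> \<in> elts c" for \<beta>
  proof -
    have "lex_sup L \<beta>"
      using that mem_c by blast
    then obtain x where "x \<in> L" "\<beta> \<in> elts x" "\<forall>\<gamma>\<in>elts \<beta>. \<gamma> \<in> elts x \<longleftrightarrow> lex_sup L \<gamma>"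
      unfolding lex_sup_iff[of L \<beta>] by blast
    then show ?thesis
      using mem_c ordinal_trans[OF \<alpha> _ that(1)] unfolding agree_below_def by blast
  qed
  have below: "num_less a c" if a: "a \<in> L" for a
  proof (rule ccontr)
    assume "\<not> num_less a c"
    moreover have "a \<noteq> c"
      using a \<alpha>_notin[of a] c(3) by auto
    ultimately obtain \<delta> where \<delta>: "less_at \<delta> c a"
      using a LR(1) c(1) num_less_linear num_less_iff by (metis UnI1)
    then have "\<delta> \<in> elts \<alpha>"
      using a LR(2) unfolding less_at_def by blast
    then have "\<forall>\<gamma>\<in>elts \<delta>. \<gamma> \<in> elts a \<longleftrightarrow> lex_sup L \<gamma>"
      using \<delta> mem_c ordinal_trans[OF \<alpha>] unfolding less_at_def agree_below_def by blast
    then have "lex_sup L \<delta>"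
      using \<delta> a unfolding less_at_def lex_sup_iff[of L \<delta>] by blast
    then show False
      using \<delta> \<open>\<delta> \<in> elts \<alpha>\<close> mem_c unfolding less_at_def by blast
  qed
  have above: "num_less c b" if b: "b \<in> R" for b
  proof (rule ccontr)
    assume "\<not> num_less c b"
    moreover have "b \<noteq> c"
      using b \<alpha>_notin[of b] c(3) by auto
    ultimately obtain \<delta> where \<delta>: "less_at \<delta> b c"
      using b LR(1) c(1) num_less_linear num_less_iff by (metis UnI2)
    have lower: "num_less x b" if "x \<in> L" for x
      using that b cut by simp
    show False
    proof (cases "\<delta> = \<alpha>")
      case False
      \<comment> \<open>A member of \<open>L\<close> that branches from \<open>b\<close> together with \<open>c\<close> exceeds \<open>b\<close>.\<close>
      then obtain x where "x \<in> L" "\<delta> \<in> elts x" "agree_below \<delta> x c"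
        using \<delta> witness[of \<delta>] unfolding less_at_def by (auto simp: c(3))
      then have "less_at \<delta> b x"
        using \<delta> unfolding less_at_def agree_below_def by blast
      then show False
        using lower[OF \<open>x \<in> L\<close>] \<open>x \<in> L\<close> b LR(1) num_lessI num_less_asym by blast
    next
      case True
      \<comment> \<open>Here \<open>b\<close> is the supremum itself. A member of \<open>L\<close> agrees with it up to and including its last
        element, and so is at least \<open>b\<close>.\<close>
      then have agree: "\<gamma> \<in> elts b \<longleftrightarrow> \<gamma> \<in> elts c" if "\<gamma> \<in> elts \<alpha>" for \<gamma>
        using \<delta> that unfolding less_at_def agree_below_def by blast
      have b': "b \<in> NO" "birthday b \<in> elts b" "birthday b \<in> elts \<alpha>"
        using b LR(1) born birthday_mem by auto
      then obtain x where x: "x \<in> L" "birthday b \<in> elts x" "agree_below (birthday b) x c"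
        using witness agree by blast
      then obtain \<epsilon> where \<epsilon>: "less_at \<epsilon> x b"
        using lower[OF x(1)] b'(1) LR(1) num_less_iff by blast
      then have "\<epsilon> \<in> elts (birthday b)"
        using x(2) b' elts_le_birthday unfolding less_at_def ord_le_def by blast
      then show False
        using \<epsilon> x(3) agree ordinal_trans[OF \<alpha>] b'(3) unfolding less_at_def agree_below_def by blast
    qed
  qed
  show ?thesis
    using that[of c] c below above unfolding NO_bd_def by simp
qed

text \<open>
  Replacement and union bound the birthdays in \<open>L\<close> and those in \<open>R\<close>; the larger bound serves both.
\<close>

lemma cut_filled:
  fixes L R :: "'v::zf set"
  assumes cut: "conway_cut num_less NO (L, R)"
  obtains c where "c \<in> NO" "between (L, R) c"
proof -
  have bound: "\<exists>\<alpha>. ordinal \<alpha> \<and> birthday ` X \<subseteq> elts \<alpha>" if "is_set X" "X \<subseteq> NO" for X :: "'v set"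
  proof -
    have "is_set (birthday ` X)"
      using that(1) replacement[of birthday] unfolding is_set_def by blast
    moreover have "ordinal \<beta>" if "\<beta> \<in> birthday ` X" for \<beta>
      using that \<open>X \<subseteq> NO\<close> ordinal_birthday by blast
    ultimately obtain \<alpha> where "ordinal \<alpha>" "birthday ` X \<subseteq> elts \<alpha>"
      by (rule ordinals_bounded)
    then show ?thesis by blast
  qed
  obtain \<kappa> where \<kappa>: "ordinal \<kappa>" "birthday ` L \<subseteq> elts \<kappa>"
    using bound[of L] cut by auto
  obtain \<rho> where \<rho>: "ordinal \<rho>" "birthday ` R \<subseteq> elts \<rho>"
    using bound[of R] cut by auto
  have "elts \<kappa> \<subseteq> elts \<rho> \<or> elts \<rho> \<subseteq> elts \<kappa>"
    using ordinal_linear[OF \<kappa>(1) \<rho>(1)] \<kappa>(1) \<rho>(1) unfolding ordinal_def by blast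
  then obtain \<alpha> where "ordinal \<alpha>" "birthday ` (L \<union> R) \<subseteq> elts \<alpha>"
  proof
    assume "elts \<kappa> \<subseteq> elts \<rho>"
    then show ?thesis
      using \<kappa>(2) \<rho> by (intro that[of \<rho>]) (simp_all add: image_Un)
  next
    assume "elts \<rho> \<subseteq> elts \<kappa>"
    then show ?thesis
      using \<kappa> \<rho>(2) by (intro that[of \<kappa>]) (simp_all add: image_Un)
  qed
  then obtain c where "c \<in> NO_bd \<alpha>" "between (L, R) c"
    using cut_filled_at_ordinal[OF cut, of \<alpha>] by blast
  then show ?thesis
    using that unfolding NO_bd_def by blast
qed

section \<open>The simplest number in a cut\<close>

lemma between_convex:
  fixes C :: "'v::zf cut"
  assumes cut: "conway_cut num_less NO C" and "between C x" "between C y"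
    and NO: "x \<in> NO" "d \<in> NO" "y \<in> NO" and "num_less x d" "d = y \<or> num_less d y"
  shows "between C d"
proof -
  obtain L R where [simp]: "C = (L, R)" by (cases C)
  have "num_less a d" if "a \<in> L" for a
    using that assms num_less_trans[of a x d] by auto
  moreover have "num_less d b" if "b \<in> R" for b
    using that assms num_less_trans[of d y b] by auto
  ultimately show ?thesis by simp
qed

lemma simplest_between_simpler:
  fixes C :: "'v::zf cut"
  assumes cut: "conway_cut num_less NO C" and c: "simplest_between C c"
    and y: "y \<in> NO" "between C y"
  shows "simpler c y"
proof -
  have c': "c \<in> NO" "between C c"
    and minimal: "\<And>d. \<lbrakk>d \<in> NO; between C d\<rbrakk> \<Longrightarrow> ord_le (birthday c) (birthday d)"
    using c unfolding simplest_between_def by blast+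
  have "agree_below (birthday c) c y"
  proof (cases "c = y")
    case True
    then show ?thesis unfolding agree_below_def by blast
  next
    case False
    \<comment> \<open>Whichever of \<open>c\<close> and \<open>y\<close> is smaller, their common initial segment also fills the cut, so
      it is not born before \<open>c\<close>.\<close>
    have "\<exists>\<delta>. (less_at \<delta> c y \<or> less_at \<delta> y c) \<and> ord_le (birthday c) \<delta>"
      using num_less_linear[OF c'(1) y(1) False]
    proof
      assume "num_less c y"
      then obtain \<delta> where \<delta>: "less_at \<delta> c y"
        using c' y num_less_iff by blast
      from c'(1) y(1) \<delta> obtain d where
        "d \<in> NO" "birthday d = \<delta>" "num_less c d" "d = y \<or> num_less d y"
        by (rule branching_point)
      then show ?thesis
        using \<delta> minimal between_convex[OF cut c'(2) y(2) c'(1) _ y(1)] by blast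
    next
      assume "num_less y c"
      then obtain \<delta> where \<delta>: "less_at \<delta> y c"
        using c' y num_less_iff by blast
      from y(1) c'(1) \<delta> obtain d where
        "d \<in> NO" "birthday d = \<delta>" "num_less y d" "d = c \<or> num_less d c"
        by (rule branching_point)
      then show ?thesis
        using \<delta> minimal between_convex[OF cut y(2) c'(2) y(1) _ c'(1)] by blast
    qed
    then obtain \<delta> where \<delta>: "less_at \<delta> c y \<or> less_at \<delta> y c" "ord_le (birthday c) \<delta>"
      by blast
    moreover have "ordinal \<delta>"
      using \<delta>(1) c' y NO_ordinal unfolding less_at_def by blast
    ultimately show ?thesis
      using ordinal_trans[of \<delta>] unfolding less_at_def agree_below_def ord_le_def by blast
  qed
  then show ?thesis
    using minimal[OF y] unfolding simpler_def agree_below_def by blast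
qed

lemma simpler_antisym:
  fixes x y :: "'v::zf"
  assumes NO: "x \<in> NO" "y \<in> NO" and xy: "simpler x y" and yx: "simpler y x"
  shows "x = y"
proof -
  have b: "birthday x = birthday y"
    using xy yx ord_le_antisym unfolding simpler_def by blast
  have "\<beta> \<in> elts x \<longleftrightarrow> \<beta> \<in> elts y" for \<beta>
  proof (cases "\<beta> \<in> elts (birthday x)")
    case True
    then show ?thesis using xy unfolding simpler_def by blast
  next
    case False
    then show ?thesis
      using NO b birthday_mem elts_le_birthday unfolding ord_le_def by metis
  qed
  then show ?thesis
    by (intro extensionality) blast
qed

lemma ex1_simplest_between:
  fixes C :: "'v::zf cut"
  assumes cut: "conway_cut num_less NO C"
  shows "\<exists>!c. simplest_between C c"
proof -
  obtain c0 where "c0 \<in> NO" "between C c0"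
    using cut cut_filled by (metis surj_pair)
  then have "birthday c0 \<in> birthday ` {c \<in> NO. between C c}"
    by blast
  then obtain \<mu> where \<mu>: "\<mu> \<in> birthday ` {c \<in> NO. between C c}"
    "\<And>\<beta>. \<beta> \<in> elts \<mu> \<Longrightarrow> \<beta> \<notin> birthday ` {c \<in> NO. between C c}"
    by (rule elts_minimal[where A = "birthday ` {c \<in> NO. between C c}"]) metis
  from \<mu>(1) obtain c where c: "c \<in> NO" "between C c" "birthday c = \<mu>"
    by blast
  have "ord_le (birthday c) (birthday d)" if "d \<in> NO" "between C d" for d
    using that c \<mu>(2) by (intro ordinal_not_mem) (auto intro: ordinal_birthday)
  then have "simplest_between C c"
    using c unfolding simplest_between_def by blast
  moreover have "d = e" if "simplest_between C d" "simplest_between C e" for d e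
  proof (rule simpler_antisym)
    show "d \<in> NO" "e \<in> NO"
      using that unfolding simplest_between_def by blast+
    show "simpler d e" "simpler e d"
      using that simplest_between_simpler[OF cut] unfolding simplest_between_def by blast+
  qed
  ultimately show ?thesis by blast
qed

lemma simplest_between_cut_number:
  fixes C :: "'v::zf cut"
  assumes "conway_cut num_less NO C"
  shows "simplest_between C (cut_number C)"
  unfolding cut_number_def using ex1_simplest_between[OF assms] by (rule theI')

lemma cut_number_eqI:
  fixes C :: "'v::zf cut"
  assumes "conway_cut num_less NO C" "simplest_between C c"
  shows "cut_number C = c"
  using assms ex1_simplest_between simplest_between_cut_number by blast

section \<open>Cuesta-Dutari cuts in the numbers born before an ordinal\<close>

lemma cd_cut_imp_conway_cut:
  fixes \<alpha> :: "'v::zf"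
  assumes "cd_cut num_less (NO_below \<alpha>) C"
  shows "conway_cut num_less NO C"
  using assms by (cases C) (auto simp: NO_below_def)

text \<open>
  The number is born no later than \<open>\<alpha>\<close> because the cut is filled at \<open>\<alpha>\<close>. It is not born earlier:
  then it would belong to one side of its own cut.
\<close>

lemma cut_number_in_NO_bd:
  fixes \<alpha> :: "'v::zf"
  assumes \<alpha>: "ordinal \<alpha>" and cd: "cd_cut num_less (NO_below \<alpha>) C"
  shows "cut_number C \<in> NO_bd \<alpha>"
proof -
  obtain L R where C: "C = (L, R)" by (cases C)
  have LR: "NO_below \<alpha> = L \<union> R"
    using cd C by simp
  have cut: "conway_cut num_less NO (L, R)"
    using cd_cut_imp_conway_cut[OF cd] C by simp
  obtain c where c: "c \<in> NO_bd \<alpha>" "between C c"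
    using cut_filled_at_ordinal[OF cut \<alpha>] LR C unfolding NO_below_def by blast
  have s: "simplest_between C (cut_number C)"
    using simplest_between_cut_number cut C by blast
  then have "ord_le (birthday (cut_number C)) \<alpha>"
    using c unfolding simplest_between_def NO_bd_def by blast
  moreover have "cut_number C \<notin> NO_below \<alpha>"
    using s LR C num_less_irrefl unfolding simplest_between_def by auto
  ultimately show ?thesis
    using s unfolding simplest_between_def NO_bd_def NO_below_def ord_le_def by blast
qed

lemma number_cut_eq:
  "number_cut \<alpha> c = ({y \<in> NO_below \<alpha>. num_less y c}, {z \<in> NO_below \<alpha>. num_less c z})"
  unfolding number_cut_def NO_below_def by blast

lemma NO_below_in_NO: "x \<in> NO_below \<alpha> \<Longrightarrow> x \<in> NO"
  unfolding NO_below_def by blast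

lemma NO_bd_in_NO: "x \<in> NO_bd \<alpha> \<Longrightarrow> x \<in> NO"
  unfolding NO_bd_def by blast

lemma cd_cut_number_cut:
  fixes \<alpha> :: "'v::zf"
  assumes \<alpha>: "ordinal \<alpha>" and c: "c \<in> NO_bd \<alpha>"
  shows "cd_cut num_less (NO_below \<alpha>) (number_cut \<alpha> c)"
proof -
  obtain N where N: "elts N = NO_below \<alpha>"
    using is_set_NO_below[OF \<alpha>] by (rule is_setE)
  have "num_less x c \<or> num_less c x" if "x \<in> NO_below \<alpha>" for x
    using that c NO_bd_disjoint NO_below_in_NO NO_bd_in_NO num_less_linear by metis
  moreover have "num_less a b"
    if "a \<in> NO_below \<alpha>" "num_less a c" "b \<in> NO_below \<alpha>" "num_less c b" for a b
    using that c NO_below_in_NO NO_bd_in_NO num_less_trans by metis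
  moreover have "is_set {x \<in> NO_below \<alpha>. P x}" for P
    using N by (intro is_set_subset[of _ N]) blast
  ultimately show ?thesis
    unfolding number_cut_eq by auto
qed

lemma number_cut_cut_number:
  fixes \<alpha> :: "'v::zf"
  assumes cd: "cd_cut num_less (NO_below \<alpha>) C"
  shows "number_cut \<alpha> (cut_number C) = C"
proof -
  obtain L R where C: "C = (L, R)" by (cases C)
  let ?c = "cut_number C"
  have LR: "NO_below \<alpha> = L \<union> R"
    using cd C by simp
  have c: "?c \<in> NO" "\<forall>a\<in>L. num_less a ?c" "\<forall>b\<in>R. num_less ?c b"
    using simplest_between_cut_number[OF cd_cut_imp_conway_cut[OF cd]] C
    unfolding simplest_between_def by auto
  have asym: "\<not> (num_less x ?c \<and> num_less ?c x)" if "x \<in> NO_below \<alpha>" for x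
    using that c(1) NO_below_in_NO num_less_asym by blast
  have "{y \<in> NO_below \<alpha>. num_less y ?c} = L" "{z \<in> NO_below \<alpha>. num_less ?c z} = R"
    using LR c asym by blast+
  then show ?thesis
    unfolding number_cut_eq using C by simp
qed

lemma cut_number_number_cut:
  fixes \<alpha> :: "'v::zf"
  assumes \<alpha>: "ordinal \<alpha>" and c: "c \<in> NO_bd \<alpha>"
  shows "cut_number (number_cut \<alpha> c) = c"
proof (rule cut_number_eqI)
  let ?C = "number_cut \<alpha> c"
  have cd: "cd_cut num_less (NO_below \<alpha>) ?C"
    using \<alpha> c by (rule cd_cut_number_cut)
  then show cut: "conway_cut num_less NO ?C"
    by (rule cd_cut_imp_conway_cut)
  have "birthday (cut_number ?C) = birthday c"
    using cut_number_in_NO_bd[OF \<alpha> cd] c unfolding NO_bd_def by simp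
  moreover have "between ?C c"
    unfolding number_cut_eq by simp
  ultimately show "simplest_between ?C c"
    using simplest_between_cut_number[OF cut] NO_bd_in_NO[OF c]
    unfolding simplest_between_def by simp
qed

section \<open>The completion\<close>

lemma strictly_ordered_NO_below: "strictly_ordered num_less (NO_below (\<alpha>::'v::zf))"
  unfolding strictly_ordered_def
proof (intro conjI irreflp_onI transp_onI totalp_onI)
  show "\<not> num_less x x" for x :: 'v
    by (rule num_less_irrefl)
  show "num_less x z" if "x \<in> NO_below \<alpha>" "y \<in> NO_below \<alpha>" "z \<in> NO_below \<alpha>"
    "num_less x y" "num_less y z" for x y z
    using that NO_below_in_NO num_less_trans[of x y z] by blast
  show "num_less x y \<or> num_less y x" if "x \<in> NO_below \<alpha>" "y \<in> NO_below \<alpha>" "x \<noteq> y" for x y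
    using that NO_below_in_NO num_less_linear[of x y] by blast
qed

text \<open>
  Inclusion of lower sections follows from transitivity. It is strict because the lower section
  determines the upper one, hence the whole cut, hence the number.
\<close>

lemma num_less_imp_lower_psubset:
  fixes \<alpha> :: "'v::zf"
  assumes \<alpha>: "ordinal \<alpha>" and x: "x \<in> NO_bd \<alpha>" and y: "y \<in> NO_bd \<alpha>" and less: "num_less x y"
  shows "fst (number_cut \<alpha> x) \<subset> fst (number_cut \<alpha> y)"
proof -
  have NO: "x \<in> NO" "y \<in> NO"
    using x y NO_bd_in_NO by blast+
  have upper: "{v \<in> NO_below \<alpha>. num_less z v} = NO_below \<alpha> - {u \<in> NO_below \<alpha>. num_less u z}"
    if "z \<in> NO_bd \<alpha>" for z
  proof -
    have "num_less z v \<longleftrightarrow> \<not> num_less v z" if "v \<in> NO_below \<alpha>" for v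
      using that \<open>z \<in> NO_bd \<alpha>\<close> NO_bd_disjoint NO_below_in_NO NO_bd_in_NO num_less_linear
        num_less_asym by metis
    then show ?thesis by blast
  qed
  have "fst (number_cut \<alpha> x) \<noteq> fst (number_cut \<alpha> y)"
  proof
    assume "fst (number_cut \<alpha> x) = fst (number_cut \<alpha> y)"
    then have "number_cut \<alpha> x = number_cut \<alpha> y"
      unfolding number_cut_eq upper[OF x] upper[OF y] by simp
    then have "x = y"
      using cut_number_number_cut[OF \<alpha>] x y by metis
    with less show False
      using num_less_irrefl by blast
  qed
  moreover have "fst (number_cut \<alpha> x) \<subseteq> fst (number_cut \<alpha> y)"
    unfolding number_cut_eq
    using num_less_trans[OF _ NO _ less] NO_below_in_NO by auto
  ultimately show ?thesis by blast
qed

lemma num_less_iff_lower_psubset: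
  fixes \<alpha> :: "'v::zf"
  assumes \<alpha>: "ordinal \<alpha>" and x: "x \<in> NO_bd \<alpha>" and y: "y \<in> NO_bd \<alpha>"
  shows "num_less x y \<longleftrightarrow> fst (number_cut \<alpha> x) \<subset> fst (number_cut \<alpha> y)"
  using num_less_imp_lower_psubset[OF \<alpha>] num_less_linear x y NO_bd_in_NO
  by (metis psubset_imp_subset psubsetE)

lemma NO_below_succ_is_cd_completion:
  fixes \<alpha> :: "'v::zf"
  assumes \<alpha>: "ordinal \<alpha>"
  shows "is_cd_completion (\<lambda>x. if x \<in> NO_bd \<alpha> then Inr (number_cut \<alpha> x) else Inl x)
    num_less (NO_below (ord_succ \<alpha>)) (NO_below \<alpha>)"
proof -
  let ?\<phi> = "\<lambda>x. if x \<in> NO_bd \<alpha> then Inr (number_cut \<alpha> x) else Inl x"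
  let ?cuts = "{C. cd_cut num_less (NO_below \<alpha>) C}"
  have on_below: "?\<phi> x = Inl x" if "x \<in> NO_below \<alpha>" for x
    using that NO_bd_disjoint by auto
  have "bij_betw ?\<phi> (NO_below \<alpha>) (Inl ` NO_below \<alpha>)"
    using on_below by (auto simp: bij_betw_def inj_on_def)
  moreover have "bij_betw (number_cut \<alpha>) (NO_bd \<alpha>) ?cuts"
    using cut_number_in_NO_bd[OF \<alpha>] cd_cut_number_cut[OF \<alpha>] number_cut_cut_number
      cut_number_number_cut[OF \<alpha>]
    by (intro bij_betw_byWitness[where f' = cut_number]) blast+
  then have "bij_betw ?\<phi> (NO_bd \<alpha>) (Inr ` ?cuts)"
    by (auto simp: bij_betw_def inj_on_def)
  ultimately have "bij_betw ?\<phi> (NO_below \<alpha> \<union> NO_bd \<alpha>) (Inl ` NO_below \<alpha> \<union> Inr ` ?cuts)"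
    by (rule bij_betw_combine) blast
  then have bij: "bij_betw ?\<phi> (NO_below (ord_succ \<alpha>)) (cd_completion num_less (NO_below \<alpha>))"
    unfolding cd_completion_def Plus_def NO_below_ord_succ[OF \<alpha>] .
  have mono: "num_less x y \<longleftrightarrow> cd_less num_less (?\<phi> x) (?\<phi> y)"
    if "x \<in> NO_below (ord_succ \<alpha>)" "y \<in> NO_below (ord_succ \<alpha>)" for x y
  proof -
    have *: "x \<in> NO_bd \<alpha> \<or> x \<notin> NO_bd \<alpha> \<and> x \<in> NO_below \<alpha>" "y \<in> NO_bd \<alpha> \<or> y \<notin> NO_bd \<alpha> \<and> y \<in> NO_below \<alpha>"
      using that NO_below_ord_succ[OF \<alpha>] by blast+
    show ?thesis
      using * num_less_iff_lower_psubset[OF \<alpha>, of x y] by (auto simp: number_cut_eq)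
  qed
  show ?thesis
    unfolding is_cd_completion_def
    using is_set_NO_below[OF \<alpha>] strictly_ordered_NO_below bij on_below mono by blast
qed

theorem theorem2p72:
  shows
    "(\<forall>C :: 'v::zf cut. conway_cut num_less NO C \<longrightarrow>
        (\<exists>!c. simplest_between C c) \<and>
        simplest_between C (cut_number C) \<and>
        (\<forall>y\<in>NO. between C y \<longrightarrow> simpler (cut_number C) y)) \<and>
     (\<forall>\<alpha> :: 'v. ordinal \<alpha> \<longrightarrow>
        (\<forall>C. cd_cut num_less (NO_below \<alpha>) C \<longrightarrow> cut_number C \<in> NO_bd \<alpha>) \<and>
        (\<forall>c\<in>NO_bd \<alpha>. cd_cut num_less (NO_below \<alpha>) (number_cut \<alpha> c)) \<and>
        (\<forall>C. cd_cut num_less (NO_below \<alpha>) C \<longrightarrow> number_cut \<alpha> (cut_number C) = C) \<and>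
        (\<forall>c\<in>NO_bd \<alpha>. cut_number (number_cut \<alpha> c) = c) \<and>
        NO_below (ord_succ \<alpha>) = NO_below \<alpha> \<union> NO_bd \<alpha> \<and>
        is_cd_completion (\<lambda>x. if x \<in> NO_bd \<alpha> then Inr (number_cut \<alpha> x) else Inl x)
          num_less (NO_below (ord_succ \<alpha>)) (NO_below \<alpha>))"
proof (intro conjI allI impI ballI)
  fix C :: "'v cut"
  assume cut: "conway_cut num_less NO C"
  then show "\<exists>!c. simplest_between C c" "simplest_between C (cut_number C)"
    by (rule ex1_simplest_between, rule simplest_between_cut_number)
  then show "simpler (cut_number C) y" if "y \<in> NO" "between C y" for y
    using that simplest_between_simpler[OF cut] by blast
qed (use cut_number_in_NO_bd cd_cut_number_cut number_cut_cut_number cut_number_number_cut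
    NO_below_ord_succ NO_below_succ_is_cd_completion in blast)+

end
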